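(* Let $k\ge 2$ be an integer. Then, for $s,q\in\mathbb{R}\cup\{\pm\infty\}$: (i) for all $s\ge 1$ and $q>0$, $\mathfrak{M}_{k,s,q}$ is not a Hardy mean; (ii) for every $q\le 0$, $\mathfrak{M}_{k,1,q}$ is a Hardy mean; (iii) for every $s<1$ and every $q\in\mathbb{R}\cup\{\pm\infty\}$, $\mathfrak{M}_{k,s,q}$ is a Hardy mean.
   Context: Power means: for $p\in\mathbb{R}\cup\{\pm\infty\}$ and a vector $(v_1,\ldots,v_n)$ with all components positive, $\mathfrak{N}_p(v_1,\ldots,v_n)$ equals $\left(\frac1n\sum_{i=1}^n v_i^p\right)^{1/p}$ if $p\in\mathbb{R}\setminus\{0\}$, $\left(\prod_{i=1}^n v_i\right)^{1/n}$ if $p=0$, $\min(v_1,\ldots,v_n)$ if $p=-\infty$, and $\max(v_1,\ldots,v_n)$ if $p=\infty$. Generalized power means: for a positive integer $k$, $s,q\in\mathbb{R}\cup\{\pm\infty\}$ and a vector $(v_1,\ldots,v_n)$ of positive reals, define $\mathfrak{M}_{k,s,q}(v_1,\ldots,v_n)$ as follows. If $k\ge n$, it equals $\mathfrak{N}_q(v_1,\ldots,v_n)$. If $k<n$, it equals the power mean $\mathfrak{N}_s$ of the vector of length $\binom{n}{k}$ whose entries are the numbers $\mathfrak{N}_q(v_{i_1},\ldots,v_{i_k})$, one for each $k$-element subset $\{i_1,\ldots,i_k\}\subset\{1,\ldots,n\}$. Hardy mean: a mean $\mathfrak{A}$ (defined on vectors of positive reals of every length $n\ge1$) is a Hardy mean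 if there exists a constant $C$ such that $\sum_{n=1}^\infty \mathfrak{A}(a_1,\ldots,a_n)<C\|a\|_1$ for every sequence $a=(a_n)_{n\ge1}$ of positive reals with $\|a\|_1=\sum_{n=1}^\infty a_n<\infty$. *)

theory Defs
  imports Complex_Main "HOL-Library.Extended_Real"
begin

text \<open>
  The power mean of a finite nonempty family \<open>v\<close> of positive reals with index set \<open>I\<close>.
  Indexing by an arbitrary finite set lets the same definition serve for vectors and for
  the family of means over all \<open>k\<close>-element subsets, repeated values being counted with
  multiplicity.
\<close>

definition power_mean :: "ereal \<Rightarrow> 'i set \<Rightarrow> ('i \<Rightarrow> real) \<Rightarrow> real" where
  "power_mean p I v =
    (case p of
       ereal r \<Rightarrow>
         (if r = 0 then (\<Prod>i\<in>I. v i) powr (1 / real (card I))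
          else ((\<Sum>i\<in>I. v i powr r) / real (card I)) powr (1 / r))
     | PInfty \<Rightarrow> Max (v ` I)
     | MInfty \<Rightarrow> Min (v ` I))"

definition gen_power_mean :: "nat \<Rightarrow> ereal \<Rightarrow> ereal \<Rightarrow> real list \<Rightarrow> real" where
  "gen_power_mean k s q vs =
    (let n = length vs in
     if n \<le> k then power_mean q {..<n} (\<lambda>i. vs ! i)
     else power_mean s {J. J \<subseteq> {..<n} \<and> card J = k}
            (\<lambda>J. power_mean q J (\<lambda>i. vs ! i)))"

text \<open>
  Sequences are indexed from \<open>0\<close>, so the \<open>n\<close>-th term of the series is the mean of the
  first \<open>n + 1\<close> entries. Summability of the series of means is required explicitly because
  \<^const>\<open>suminf\<close> is a total function; for a positive sequence \<open>suminf a\<close> is its 1-norm.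
\<close>

definition hardy_mean :: "(real list \<Rightarrow> real) \<Rightarrow> bool" where
  "hardy_mean A \<longleftrightarrow>
    (\<exists>C::real. \<forall>a::nat \<Rightarrow> real.
       (\<forall>n. a n > 0) \<longrightarrow> summable a \<longrightarrow>
         summable (\<lambda>n. A (map a [0..<Suc n])) \<and>
         (\<Sum>n. A (map a [0..<Suc n])) < C * (\<Sum>n. a n))"

end

theory Submission imports Defs "HOL-Analysis.Convex" "HOL-Analysis.Summation_Tests" begin

text \<open>
  The whole question is decided by which ordinary power mean \<open>N\<^sub>p\<close> the generalized mean
  \<open>M = M\<^sub>k\<^sub>,\<^sub>s\<^sub>,\<^sub>q\<close> is comparable to. Hardy's inequality makes \<open>N\<^sub>p\<close> a Hardy mean for
  \<open>0 < p < 1\<close>, and so is every mean bounded by a constant multiple of such an \<open>N\<^sub>p\<close>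
  (\<open>hardy_mean_if_le_power_mean\<close>); constants are irrelevant throughout.

  For \<open>s < 1\<close>, an outer exponent \<open>s \<le> 0\<close> can be raised to some \<open>p \<in> (0, 1)\<close> by the
  AM-GM inequality, so let \<open>0 < s = p < 1\<close>. The inner mean over a \<open>k\<close>-subset \<open>J\<close> is at most
  the largest entry, hence its \<open>p\<close>-th power is at most \<open>\<Sum>i\<in>J. v i powr p\<close>. Averaging over
  all \<open>J\<close> counts every index with weight \<open>k / n\<close>, so \<open>M \<le> k powr (1/p) * N\<^sub>p\<close>
  (\<open>gen_power_mean_le\<close>).

  For \<open>s = 1\<close> and \<open>q \<le> 0\<close> the inner mean is at most the geometric mean, i.e. a product of
  the numbers \<open>x i = v i powr (1/k)\<close>. The average of these products over all \<open>J\<close> is an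
  elementary symmetric polynomial divided by \<open>n choose k\<close>. The former is at most
  \<open>(\<Sum>i. x i) ^ k\<close> and the latter is at least \<open>(n/k) ^ k\<close>, which bounds \<open>M\<close> by
  \<open>k ^ k * N\<^sub>1\<^sub>/\<^sub>k\<close> (\<open>gen_power_mean_1_le\<close>). Here \<open>k \<ge> 2\<close> gives \<open>1/k < 1\<close>.

  For \<open>s \<ge> 1\<close> and \<open>q > 0\<close> every subset containing the first index has inner mean at least
  a fixed multiple of the first entry. These subsets make up a fraction \<open>k / n\<close> of all of them,
  so \<open>M\<close> is at least a constant times \<open>a\<^sub>0 / n\<close> (\<open>gen_power_mean_ge_first\<close>), and the
  harmonic series diverges.
\<close>

section \<open>Elementary bounds for power means\<close>

lemma power_mean_zero:
  "power_mean 0 I v = (\<Prod>i\<in>I. v i) powr (1 / real (card I))"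
  by (simp add: power_mean_def zero_ereal_def)

lemma power_mean_real:
  "r \<noteq> 0 \<Longrightarrow> power_mean (ereal r) I v = ((\<Sum>i\<in>I. v i powr r) / real (card I)) powr (1 / r)"
  by (simp add: power_mean_def)

lemma power_mean_infinity: "power_mean \<infinity> I v = Max (v ` I)"
  by (simp add: power_mean_def)

lemma power_mean_minus_infinity: "power_mean (- \<infinity>) I v = Min (v ` I)"
  by (simp add: power_mean_def)

lemma power_mean_pos:
  assumes "finite I" "I \<noteq> {}" "\<And>i. i \<in> I \<Longrightarrow> v i > 0"
  shows "power_mean p I v > 0"
proof (cases p)
  case (real r)
  have "(\<Prod>i\<in>I. v i) > 0"
    using assms(3) by (rule prod_pos)
  moreover have nz: "v i \<noteq> 0" if "i \<in> I" for i
    using assms(3)[OF that] by simp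
  then have "(\<Sum>i\<in>I. v i powr r) > 0"
    using assms(1,2) by (intro sum_pos) (simp_all add: nz)
  moreover have "card I > 0"
    using assms(1,2) by (simp add: card_gt_0_iff)
  ultimately show ?thesis
    unfolding real power_mean_def by simp
next
  case PInf
  have "Max (v ` I) > 0" using assms by (subst Max_gr_iff) auto
  then show ?thesis using PInf by (simp add: power_mean_infinity)
next
  case MInf
  have "Min (v ` I) > 0" using assms by (subst Min_gr_iff) auto
  then show ?thesis using MInf by (simp add: power_mean_minus_infinity)
qed

lemma power_mean_le:
  assumes I: "finite I" "I \<noteq> {}" and v: "\<And>i. i \<in> I \<Longrightarrow> 0 < v i" "\<And>i. i \<in> I \<Longrightarrow> v i \<le> M"
  shows "power_mean p I v \<le> M"
proof -
  have M: "M > 0" and card: "card I > 0"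
    using I v by (force, simp add: card_gt_0_iff)
  have prod: "(\<Prod>i\<in>I. v i) \<le> M ^ card I"
    using prod_mono[of I v "\<lambda>_. M"] v by (simp add: less_imp_le)
  have zero: "power_mean 0 I v \<le> M"
  proof -
    have "(\<Prod>i\<in>I. v i) powr (1 / real (card I)) \<le> (M ^ card I) powr (1 / real (card I))"
      using prod v by (intro powr_mono2) (auto intro: prod_nonneg less_imp_le)
    also have "\<dots> = M"
      using M card by (simp add: powr_powr flip: powr_realpow)
    finally show ?thesis by (simp add: power_mean_zero)
  qed
  have nonzero: "power_mean (ereal r) I v \<le> M" if "r \<noteq> 0" for r
  proof -
    have "((\<Sum>i\<in>I. v i powr r) / real (card I)) powr (1 / r) \<le> (M powr r) powr (1 / r)"
    proof (cases "r > 0")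
      case True
      then have "(\<Sum>i\<in>I. v i powr r) \<le> real (card I) * M powr r"
        using v by (intro sum_bounded_above powr_mono2) (auto simp: less_imp_le)
      then show ?thesis
        using True card by (intro powr_mono2) (auto simp: field_simps sum_nonneg)
    next
      case False
      then have "(\<Sum>i\<in>I. v i powr r) \<ge> real (card I) * M powr r"
        using v that by (intro sum_bounded_below powr_mono2') auto
      then show ?thesis
        using False that card M by (intro powr_mono2') (auto simp: field_simps sum_nonneg)
    qed
    then show ?thesis
      using that M by (simp add: power_mean_real powr_powr)
  qed
  show ?thesis
  proof (cases p)
    case (real r)
    then show ?thesis using zero nonzero
      by (cases "r = 0") (simp_all add: zero_ereal_def)
  next
    case PInf
    have "Max (v ` I) \<le> M" using I v(2) by (subst Max_le_iff) auto
    then show ?thesis using PInf by (simp add: power_mean_infinity)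
  next
    case MInf
    obtain i where "i \<in> I" using I by blast
    then have "Min (v ` I) \<le> M" using I v(2) by (intro order.trans[OF Min_le]) auto
    then show ?thesis using MInf by (simp add: power_mean_minus_infinity)
  qed
qed

text \<open>
  Every entry is at most the \<open>p\<close>-norm of the vector, and a power mean of any exponent stays below
  any bound for the entries. Unlike the maximum, the \<open>p\<close>-norm is additive after raising it to
  the power \<open>p\<close>, which allows summation over subsets.
\<close>

lemma power_mean_le_powr_sum:
  assumes I: "finite I" "I \<noteq> {}" and v: "\<And>i. i \<in> I \<Longrightarrow> 0 < v i" and p: "p > 0"
  shows "power_mean q I v \<le> (\<Sum>i\<in>I. v i powr p) powr (1 / p)"
proof (rule power_mean_le[OF I v])
  fix i assume i: "i \<in> I"
  have "v i powr p \<le> (\<Sum>i\<in>I. v i powr p)"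
    using I i by (intro member_le_sum) auto
  then have "(v i powr p) powr (1 / p) \<le> (\<Sum>i\<in>I. v i powr p) powr (1 / p)"
    using p by (intro powr_mono2) auto
  then show "v i \<le> (\<Sum>i\<in>I. v i powr p) powr (1 / p)"
    using p v[OF i] by (simp add: powr_powr)
qed auto

text \<open>
  This is the AM-GM inequality for the entries \<open>v i powr r\<close>. Both signs of \<open>r\<close> are of use:
  extracting \<open>r\<close>-th roots turns it into the comparison of \<open>power_mean 0\<close> with a positive or with a
  negative exponent.
\<close>

lemma geometric_mean_powr_le:
  fixes v :: "'i \<Rightarrow> real"
  assumes I: "finite I" "I \<noteq> {}" and v: "\<And>i. i \<in> I \<Longrightarrow> 0 < v i"
  shows "power_mean 0 I v powr r \<le> (\<Sum>i\<in>I. v i powr r) / real (card I)"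
proof -
  have "power_mean 0 I v powr r = (\<Prod>i\<in>I. v i powr r) powr (1 / real (card I))"
    by (simp add: power_mean_zero powr_powr mult.commute flip: prod_powr_distrib)
  also have "\<dots> \<le> (\<Sum>i\<in>I. v i powr r / card I)"
    using I by (intro arith_geom_mean) auto
  finally show ?thesis by (simp add: sum_divide_distrib)
qed

lemma power_mean_le_geometric:
  assumes I: "finite I" "I \<noteq> {}" and v: "\<And>i. i \<in> I \<Longrightarrow> 0 < v i" and q: "q \<le> 0"
  shows "power_mean q I v \<le> power_mean 0 I v"
proof (cases q)
  case (real r)
  show ?thesis
  proof (cases "r = 0")
    case False
    with q real have r: "r < 0" by simp
    have G: "power_mean 0 I v > 0" by (rule power_mean_pos[OF I v])
    have "((\<Sum>i\<in>I. v i powr r) / real (card I)) powr (1 / r) \<le> (power_mean 0 I v powr r) powr (1 / r)"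
      using geometric_mean_powr_le[where r = r, OF I v] r G by (intro powr_mono2') auto
    then show ?thesis
      using r G real by (simp add: power_mean_real powr_powr)
  qed (use real in \<open>simp add: zero_ereal_def\<close>)
next
  case MInf
  let ?m = "Min (v ` I)"
  have m: "?m > 0" and card: "card I > 0" using I v by (auto simp: card_gt_0_iff)
  have "?m ^ card I \<le> (\<Prod>i\<in>I. v i)"
    using prod_mono[of I "\<lambda>_. ?m" v] I m by (simp add: less_imp_le)
  then have "(?m ^ card I) powr (1 / real (card I)) \<le> (\<Prod>i\<in>I. v i) powr (1 / real (card I))"
    using m by (intro powr_mono2) auto
  then show ?thesis
    using MInf m card
    by (simp add: power_mean_minus_infinity power_mean_zero powr_powr flip: powr_realpow)
qed (use q in auto)

lemma geometric_le_power_mean: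
  assumes I: "finite I" "I \<noteq> {}" and v: "\<And>i. i \<in> I \<Longrightarrow> 0 < v i" and p: "p > 0"
  shows "power_mean 0 I v \<le> power_mean (ereal p) I v"
proof -
  have G: "power_mean 0 I v > 0" by (rule power_mean_pos[OF I v])
  have "(power_mean 0 I v powr p) powr (1 / p)
      \<le> ((\<Sum>i\<in>I. v i powr p) / real (card I)) powr (1 / p)"
    using geometric_mean_powr_le[where r = p, OF I v] p G by (intro powr_mono2) auto
  then show ?thesis
    using p G by (simp add: power_mean_real powr_powr)
qed

text \<open>
  For \<open>q > 0\<close> a single entry forces the mean up, since dropping the other terms
  of the sum costs only a factor that depends on \<open>q\<close> and the number of entries. For
  \<open>q \<le> 0\<close> and at least two entries there is no such \<open>c\<close>: one entry close to \<open>0\<close> pulls the mean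
  down to \<open>0\<close>.
\<close>

lemma power_mean_ge_member:
  assumes q: "q > 0" and k: "k > 0"
  obtains c where "c > 0"
    "\<And>(I :: 'i set) v i. card I = k \<Longrightarrow> i \<in> I \<Longrightarrow> (\<And>j. j \<in> I \<Longrightarrow> 0 < v j) \<Longrightarrow>
       c * v i \<le> power_mean q I v"
proof (cases q)
  case (real r)
  with q have r: "r > 0" by simp
  show ?thesis
  proof (rule that[of "(1 / real k) powr (1 / r)"])
    fix I :: "'i set" and v :: "'i \<Rightarrow> real" and i
    assume I: "card I = k" "i \<in> I" "\<And>j. j \<in> I \<Longrightarrow> 0 < v j"
    then have "finite I" using k card_gt_0_iff by metis
    then have "v i powr r \<le> (\<Sum>j\<in>I. v j powr r)"
      using I by (intro member_le_sum) auto
    then have "(1 / real k * v i powr r) powr (1 / r) \<le> ((\<Sum>j\<in>I. v j powr r) / real k) powr (1 / r)"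
      using r k by (intro powr_mono2) (auto simp: field_simps)
    then show "(1 / real k) powr (1 / r) * v i \<le> power_mean q I v"
      using r real I(1) I(3)[OF I(2)] by (simp add: power_mean_real powr_mult powr_powr powr_divide)
  qed (use k in simp)
next
  case PInf
  show ?thesis
  proof (rule that[of 1])
    fix I :: "'i set" and v :: "'i \<Rightarrow> real" and i
    assume I: "card I = k" "i \<in> I"
    then have "finite I" using k card_gt_0_iff by metis
    then show "1 * v i \<le> power_mean q I v"
      using I PInf by (simp add: power_mean_infinity)
  qed simp
next
  case MInf
  with q have False by simp
  then show ?thesis ..
qed

section \<open>Sums over the subsets of a given size\<close>

text \<open>
  Removing \<open>i\<close> maps these sets bijectively to the subsets of \<open>A - {i}\<close> of size \<open>k - 1\<close>.
\<close>

lemma card_subsets_containing: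
  assumes A: "finite A" "i \<in> A" and k: "k > 0"
  shows "card {J. J \<subseteq> A \<and> card J = k \<and> i \<in> J} = (card A - 1) choose (k - 1)"
proof -
  have "bij_betw (insert i) {J. J \<subseteq> A - {i} \<and> card J = k - 1} {J. J \<subseteq> A \<and> card J = k \<and> i \<in> J}"
  proof (rule bij_betw_byWitness[where f' = "\<lambda>J. J - {i}"])
    show "insert i ` {J. J \<subseteq> A - {i} \<and> card J = k - 1} \<subseteq> {J. J \<subseteq> A \<and> card J = k \<and> i \<in> J}"
    proof clarify
      fix J assume J: "J \<subseteq> A - {i}" "card J = k - 1"
      then have "finite J" "i \<notin> J" using A finite_subset by auto
      with J A k show "insert i J \<subseteq> A \<and> card (insert i J) = k \<and> i \<in> insert i J" by auto
    qed
  qed auto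
  then have "card {J. J \<subseteq> A \<and> card J = k \<and> i \<in> J} = card {J. J \<subseteq> A - {i} \<and> card J = k - 1}"
    by (simp add: bij_betw_same_card)
  also have "\<dots> = (card A - 1) choose (k - 1)"
    using A by (simp add: n_subsets)
  finally show ?thesis .
qed

lemma sum_over_subsets:
  fixes w :: "'i \<Rightarrow> real"
  assumes A: "finite A" and k: "k > 0"
  shows "(\<Sum>J | J \<subseteq> A \<and> card J = k. \<Sum>i\<in>J. w i) = real ((card A - 1) choose (k - 1)) * (\<Sum>i\<in>A. w i)"
proof -
  let ?F = "{J. J \<subseteq> A \<and> card J = k}"
  have "(\<Sum>J\<in>?F. \<Sum>i\<in>J. w i) = (\<Sum>J\<in>?F. \<Sum>i | i \<in> A \<and> i \<in> J. w i)"
    by (rule sum.cong[OF refl]) (auto intro!: sum.cong)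
  also have "\<dots> = (\<Sum>i\<in>A. \<Sum>J | J \<in> ?F \<and> i \<in> J. w i)"
    using A by (intro sum.swap_restrict) auto
  also have "\<dots> = (\<Sum>i\<in>A. real ((card A - 1) choose (k - 1)) * w i)"
  proof (rule sum.cong[OF refl])
    fix i assume "i \<in> A"
    from card_subsets_containing[OF A this k]
    show "(\<Sum>J | J \<in> ?F \<and> i \<in> J. w i) = real ((card A - 1) choose (k - 1)) * w i"
      by (simp add: conj_assoc)
  qed
  finally show ?thesis by (simp add: sum_distrib_left)
qed

lemma binomial_ratio:
  assumes "0 < k" "k \<le> n"
  shows "real ((n - 1) choose (k - 1)) / real (n choose k) = real k / real n"
proof -
  have "real k * real (n choose k) = real n * real ((n - 1) choose (k - 1))"
    using times_binomial_minus1_eq[OF assms(1), of n] by (metis of_nat_mult)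
  then show ?thesis
    using assms by (simp add: field_simps)
qed

text \<open>
  Expanding the power yields each product over \<open>k\<close> distinct indices among other nonnegative
  terms. The induction
  on \<open>A\<close> splits the \<open>k\<close>-subsets of \<open>insert a A\<close> according to whether they contain \<open>a\<close>.
\<close>

lemma sum_prod_over_subsets_le:
  fixes x :: "'i \<Rightarrow> real"
  assumes "finite A" "\<And>i. i \<in> A \<Longrightarrow> 0 \<le> x i"
  shows "(\<Sum>J | J \<subseteq> A \<and> card J = k. \<Prod>i\<in>J. x i) \<le> (\<Sum>i\<in>A. x i) ^ k"
  using assms
proof (induction A arbitrary: k rule: finite_induct)
  case empty
  have "{J :: 'i set. J = {} \<and> card J = k} = (if k = 0 then {{}} else {})" by auto
  then show ?case by simp
next
  case (insert a A)
  show ?case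
  proof (cases k)
    case 0
    have "{J. J \<subseteq> insert a A \<and> card J = 0} = {{}}"
      using insert.hyps by (auto dest: finite_subset)
    then show ?thesis using 0 by simp
  next
    case (Suc l)
    let ?F = "\<lambda>k. {J. J \<subseteq> A \<and> card J = k}"
    let ?S = "\<Sum>i\<in>A. x i"
    have split: "{J. J \<subseteq> insert a A \<and> card J = Suc l} = ?F (Suc l) \<union> insert a ` ?F l"
    proof (intro equalityI subsetI)
      fix J assume J: "J \<in> {J. J \<subseteq> insert a A \<and> card J = Suc l}"
      then have fin: "finite J" using insert.hyps finite_subset by auto
      show "J \<in> ?F (Suc l) \<union> insert a ` ?F l"
      proof (cases "a \<in> J")
        case True
        then have "J = insert a (J - {a})" "J - {a} \<in> ?F l" using J fin by auto
        then show ?thesis by blast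
      qed (use J in auto)
    next
      fix J assume "J \<in> ?F (Suc l) \<union> insert a ` ?F l"
      moreover have "finite J'" if "J' \<subseteq> A" for J'
        using that insert.hyps finite_subset by blast
      ultimately show "J \<in> {J. J \<subseteq> insert a A \<and> card J = Suc l}"
        using insert.hyps by (auto simp: card_insert_if)
    qed
    have fin: "finite (?F m)" for m using insert.hyps by simp
    have inj: "inj_on (insert a) (?F l)"
      using insert.hyps by (auto simp: inj_on_def)
    have "(\<Sum>J | J \<subseteq> insert a A \<and> card J = Suc l. \<Prod>i\<in>J. x i)
        = (\<Sum>J\<in>?F (Suc l). \<Prod>i\<in>J. x i) + (\<Sum>J\<in>insert a ` ?F l. \<Prod>i\<in>J. x i)"
      unfolding split using insert.hyps fin by (intro sum.union_disjoint) auto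
    also have "(\<Sum>J\<in>insert a ` ?F l. \<Prod>i\<in>J. x i) = (\<Sum>J\<in>?F l. \<Prod>i\<in>insert a J. x i)"
      using inj by (simp add: sum.reindex)
    also have "\<dots> = (\<Sum>J\<in>?F l. x a * (\<Prod>i\<in>J. x i))"
    proof (rule sum.cong[OF refl])
      fix J assume "J \<in> ?F l"
      then have "finite J" "a \<notin> J" using insert.hyps finite_subset by auto
      then show "(\<Prod>i\<in>insert a J. x i) = x a * (\<Prod>i\<in>J. x i)" by simp
    qed
    also have "\<dots> = x a * (\<Sum>J\<in>?F l. \<Prod>i\<in>J. x i)" by (simp add: sum_distrib_left)
    also have "(\<Sum>J\<in>?F (Suc l). \<Prod>i\<in>J. x i) + x a * (\<Sum>J\<in>?F l. \<Prod>i\<in>J. x i)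
        \<le> ?S ^ Suc l + x a * ?S ^ l"
      using insert.prems insert.IH by (intro add_mono mult_left_mono) (auto simp del: power_Suc)
    also have "\<dots> = (?S + x a) * ?S ^ l" by (simp add: algebra_simps)
    also have "\<dots> \<le> (?S + x a) * (?S + x a) ^ l"
      using insert.prems by (intro mult_left_mono power_mono) (auto intro!: sum_nonneg add_nonneg_nonneg)
    finally show ?thesis
      using insert.hyps Suc by (simp add: add.commute)
  qed
qed

section \<open>Hardy's inequality\<close>

lemma powr_minus_one_mult_self:
  "(x::real) \<ge> 0 \<Longrightarrow> x powr (r - 1) * x = x powr r"
  by (cases "x = 0") (auto simp: powr_diff)

lemma powr_mult_le_Young:
  fixes x y :: real
  assumes r: "r > 1" and x: "x \<ge> 0" and y: "y \<ge> 0"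
  shows "r * (x powr (r - 1) * y) \<le> y powr r + (r - 1) * x powr r"
proof -
  have "y * x powr (r - 1) \<le> y powr r / r + (x powr (r - 1)) powr (r / (r - 1)) / (r / (r - 1))"
    using r x y by (intro Youngs_inequality) (auto simp: field_simps)
  also have "(x powr (r - 1)) powr (r / (r - 1)) = x powr r"
    using r by (simp add: powr_powr)
  finally show ?thesis
    using r by (simp add: field_simps)
qed

text \<open>
  If \<open>y \<le> d x\<close>, replacing \<open>y\<close> by \<open>d x\<close> gives the first term; otherwise \<open>x < y / d\<close>, and
  replacing \<open>x\<close> by \<open>y / d\<close> gives the second. A small \<open>d\<close> lets the term in \<open>x\<close> be absorbed
  by a multiple of \<open>x powr r\<close> on the other side of an inequality.
\<close>

lemma powr_mult_le_split:
  fixes x y :: real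
  assumes r: "r > 1" and x: "x \<ge> 0" and y: "y \<ge> 0" and d: "d > 0"
  shows "x powr (r - 1) * y \<le> d * x powr r + d powr (1 - r) * y powr r"
proof (cases "y \<le> d * x")
  case True
  then have "x powr (r - 1) * y \<le> x powr (r - 1) * (d * x)"
    by (intro mult_left_mono) auto
  also have "\<dots> = d * x powr r"
    using powr_minus_one_mult_self[OF x, of r] by (simp add: mult_ac)
  finally show ?thesis by (simp add: add_increasing2)
next
  case False
  then have "x powr (r - 1) * y \<le> (y / d) powr (r - 1) * y"
    using r x y d by (intro mult_right_mono powr_mono2) (auto simp: field_simps)
  also have "\<dots> = d powr (1 - r) * (y powr (r - 1) * y)"
    using y d powr_minus[of d "r - 1"] by (simp add: powr_divide field_simps)
  also have "\<dots> = d powr (1 - r) * y powr r"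
    by (simp add: powr_minus_one_mult_self[OF y])
  finally show ?thesis using d by (simp add: add_increasing)
qed

text \<open>
  Elliott's proof. Write \<open>B n\<close> for the average of the first \<open>n\<close> terms, so that
  \<open>b n = (n + 1) * B (n + 1) - n * B n\<close>. Expressing \<open>r * B (n + 1) powr (r - 1) * b n\<close> in this way and
  using Young's inequality on the mixed product bounds it below by
  \<open>(r - 1) * B (n + 1) powr r\<close> plus the telescoping difference of \<open>n * B n powr r\<close>. The
  bound above comes from \<open>powr_mult_le_split\<close> with \<open>d\<close> chosen so that half of
  \<open>(r - 1) * B (n + 1) powr r\<close> is absorbed.
\<close>

lemma Hardy_inequality_finite:
  fixes b :: "nat \<Rightarrow> real"
  assumes r: "r > 1" and b: "\<And>i. b i \<ge> 0"
  shows "(\<Sum>n<N. ((\<Sum>i<Suc n. b i) / real (Suc n)) powr r)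
     \<le> 2 * r / (r - 1) * ((r - 1) / (2 * r)) powr (1 - r) * (\<Sum>n<N. b n powr r)"
proof -
  define B where "B n = (\<Sum>i<n. b i) / real n" for n
  define d where "d = (r - 1) / (2 * r)"
  have d: "d > 0" using r by (simp add: d_def)
  have B: "B n \<ge> 0" for n using b by (simp add: B_def sum_nonneg)
  have step: "(r - 1) / 2 * B (Suc n) powr r
      + (real (Suc n) * B (Suc n) powr r - real n * B n powr r) \<le> r * d powr (1 - r) * b n powr r" for n
  proof -
    have bn: "b n = real (Suc n) * B (Suc n) - real n * B n"
      by (simp add: B_def)
    have "(r + real n) * B (Suc n) powr r - real n * B n powr r
        \<le> r * real (Suc n) * B (Suc n) powr r - real n * (r * (B (Suc n) powr (r - 1) * B n))"
      using mult_left_mono[OF powr_mult_le_Young[OF r B[of "Suc n"] B[of n]], of "real n"]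
      by (simp add: algebra_simps)
    also have "\<dots> = r * real (Suc n) * (B (Suc n) powr (r - 1) * B (Suc n))
        - real n * (r * (B (Suc n) powr (r - 1) * B n))"
      by (simp only: powr_minus_one_mult_self[OF B])
    also have "\<dots> = r * (B (Suc n) powr (r - 1) * b n)"
      by (simp add: bn algebra_simps)
    also have "\<dots> \<le> r * (d * B (Suc n) powr r + d powr (1 - r) * b n powr r)"
      using r by (intro mult_left_mono powr_mult_le_split B b d) auto
    also have "\<dots> = (r * d) * B (Suc n) powr r + r * d powr (1 - r) * b n powr r"
      by (simp add: algebra_simps)
    also have "r * d = (r - 1) / 2"
      using r by (simp add: d_def)
    finally show ?thesis
      by (simp add: field_simps)
  qed
  have "(r - 1) / 2 * (\<Sum>n<N. B (Suc n) powr r) + real N * B N powr r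
      \<le> r * d powr (1 - r) * (\<Sum>n<N. b n powr r)"
  proof (induction N)
    case (Suc N)
    then show ?case using step[of N] by (simp add: algebra_simps)
  qed simp
  moreover have "real N * B N powr r \<ge> 0" by simp
  ultimately have "(r - 1) / 2 * (\<Sum>n<N. B (Suc n) powr r) \<le> r * d powr (1 - r) * (\<Sum>n<N. b n powr r)"
    by linarith
  then have "(\<Sum>n<N. B (Suc n) powr r) \<le> 2 * r / (r - 1) * d powr (1 - r) * (\<Sum>n<N. b n powr r)"
    using r by (simp add: field_simps)
  then show ?thesis by (simp only: B_def d_def)
qed

text \<open>
  Hardy's inequality with exponent \<open>r = 1 / p\<close>, applied to \<open>b n = a n powr p\<close>, bounds the
  partial sums of the power means by a multiple of the partial sums of \<open>a\<close>.
\<close>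

lemma hardy_mean_if_le_power_mean:
  assumes p: "0 < p" "p < 1" and K: "K \<ge> 0"
    and A: "\<And>vs. vs \<noteq> [] \<Longrightarrow> (\<And>i. i < length vs \<Longrightarrow> 0 < vs ! i) \<Longrightarrow>
      0 \<le> A vs \<and> A vs \<le> K * power_mean (ereal p) {..<length vs} (\<lambda>i. vs ! i)"
  shows "hardy_mean A"
proof -
  define r where "r = 1 / p"
  define H where "H = 2 * r / (r - 1) * ((r - 1) / (2 * r)) powr (1 - r)"
  have r: "r > 1" using p by (simp add: r_def)
  have H: "H \<ge> 0" using r by (simp add: H_def)
  \<comment> \<open>The summand \<open>1\<close> makes the inequality strict.\<close>
  show ?thesis
    unfolding hardy_mean_def
  proof (intro exI[of _ "K * H + 1"] allI impI)
    fix a :: "nat \<Rightarrow> real"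
    assume pos: "\<forall>n. a n > 0" and sum: "summable a"
    let ?M = "\<lambda>n. A (map a [0..<Suc n])"
    have M: "0 \<le> ?M n \<and> ?M n \<le> K * ((\<Sum>i<Suc n. a i powr p) / real (Suc n)) powr r" for n
    proof -
      have "(\<Sum>i<Suc n. (map a [0..<Suc n] ! i) powr p) = (\<Sum>i<Suc n. a i powr p)"
        by (intro sum.cong) (auto simp del: upt_Suc)
      then have "power_mean (ereal p) {..<length (map a [0..<Suc n])} (\<lambda>i. map a [0..<Suc n] ! i)
          = ((\<Sum>i<Suc n. a i powr p) / real (Suc n)) powr r"
        using p by (simp add: power_mean_real r_def del: upt_Suc sum.lessThan_Suc of_nat_Suc)
      with A[of "map a [0..<Suc n]"] pos show ?thesis
        by (simp del: upt_Suc sum.lessThan_Suc of_nat_Suc)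
    qed
    have partial: "(\<Sum>n<N. ?M n) \<le> K * H * suminf a" for N
    proof -
      have "(\<Sum>n<N. ?M n) \<le> K * (\<Sum>n<N. ((\<Sum>i<Suc n. a i powr p) / real (Suc n)) powr r)"
        unfolding sum_distrib_left using M by (intro sum_mono) blast
      also have "\<dots> \<le> K * (H * (\<Sum>n<N. (a n powr p) powr r))"
        unfolding H_def using Hardy_inequality_finite[OF r, of "\<lambda>n. a n powr p" N] K
        by (intro mult_left_mono) auto
      also have "(\<Sum>n<N. (a n powr p) powr r) = (\<Sum>n<N. a n)"
        using p pos by (intro sum.cong) (auto simp: powr_powr r_def less_imp_le)
      also have "K * (H * (\<Sum>n<N. a n)) \<le> K * (H * suminf a)"
        using K H sum pos by (intro mult_left_mono sum_le_suminf) (auto intro: less_imp_le)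
      finally show ?thesis by (simp add: mult.assoc)
    qed
    have summ: "summable ?M"
      using M partial by (intro summableI_nonneg_bounded[where x = "K * H * suminf a"]) auto
    have "suminf ?M \<le> K * H * suminf a"
      using partial summ by (intro suminf_le_const)
    also have "\<dots> < (K * H + 1) * suminf a"
      using suminf_pos[OF sum] pos by (simp add: algebra_simps)
    finally show "summable ?M \<and> suminf ?M < (K * H + 1) * suminf a"
      using summ by blast
  qed
qed

section \<open>Comparing generalized power means with power means\<close>

lemma gen_power_mean_short:
  "length vs \<le> k \<Longrightarrow> gen_power_mean k s q vs = power_mean q {..<length vs} (\<lambda>i. vs ! i)"
  by (simp add: gen_power_mean_def)

lemma gen_power_mean_long:
  "k < length vs \<Longrightarrow> gen_power_mean k s q vs =
     power_mean s {J. J \<subseteq> {..<length vs} \<and> card J = k} (\<lambda>J. power_mean q J (\<lambda>i. vs ! i))"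
  by (simp add: gen_power_mean_def)

lemma subsets_of_size_nonempty:
  "k \<le> n \<Longrightarrow> {J. J \<subseteq> {..<n::nat} \<and> card J = k} \<noteq> {}"
  using obtain_subset_with_card_n[of k "{..<n}"] by auto

lemma subset_of_size_positive:
  assumes "J \<in> {J. J \<subseteq> {..<length vs} \<and> card J = k}" "k > 0"
    and "\<And>i. i < length vs \<Longrightarrow> 0 < (vs ! i :: real)"
  shows "finite J" "J \<noteq> {}" "\<And>i. i \<in> J \<Longrightarrow> 0 < vs ! i"
proof -
  show "finite J" using assms(1) finite_subset[of J "{..<length vs}"] by simp
  show "J \<noteq> {}" using assms(1,2) by fastforce
  show "0 < vs ! i" if "i \<in> J" for i using assms(1,3) that by blast
qed

lemma gen_power_mean_pos:
  assumes k: "k > 0" and ne: "vs \<noteq> []" and vs: "\<And>i. i < length vs \<Longrightarrow> 0 < vs ! i"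
  shows "gen_power_mean k s q vs > 0"
proof (cases "length vs \<le> k")
  case True
  then show ?thesis
    unfolding gen_power_mean_short[OF True] using ne vs by (intro power_mean_pos) auto
next
  case False
  then have less: "k < length vs" by simp
  show ?thesis
    unfolding gen_power_mean_long[OF less]
  proof (rule power_mean_pos)
    fix J assume J: "J \<in> {J. J \<subseteq> {..<length vs} \<and> card J = k}"
    show "power_mean q J (\<lambda>i. vs ! i) > 0"
      using subset_of_size_positive[OF J k vs] by (rule power_mean_pos)
  qed (use less subsets_of_size_nonempty[of k "length vs"] in auto)
qed

text \<open>
  Short vectors get the same constant \<open>k powr (1 / p)\<close> as the long ones: the
  \<open>p\<close>-norm of a vector of length \<open>n\<close> is \<open>n powr (1 / p)\<close> times its power mean, and \<open>n \<le> k\<close>.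
\<close>

lemma gen_power_mean_short_le:
  assumes p: "p > 0" and ne: "vs \<noteq> []" and le: "length vs \<le> k"
    and vs: "\<And>i. i < length vs \<Longrightarrow> 0 < vs ! i"
  shows "gen_power_mean k s q vs
    \<le> real k powr (1 / p) * power_mean (ereal p) {..<length vs} (\<lambda>i. vs ! i)"
proof -
  let ?n = "length vs"
  let ?S = "\<Sum>i<?n. (vs ! i) powr p"
  have "power_mean q {..<?n} (\<lambda>i. vs ! i) \<le> ?S powr (1 / p)"
    using ne vs p by (intro power_mean_le_powr_sum) auto
  also have "\<dots> \<le> (real k * (?S / real ?n)) powr (1 / p)"
  proof (intro powr_mono2)
    have "?S * real ?n \<le> ?S * real k"
      using le by (intro mult_left_mono) (auto simp: sum_nonneg)
    then show "?S \<le> real k * (?S / real ?n)"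
      using ne by (simp add: field_simps)
  qed (use p in \<open>auto simp: sum_nonneg\<close>)
  also have "\<dots> = real k powr (1 / p) * power_mean (ereal p) {..<?n} (\<lambda>i. vs ! i)"
    using p powr_mult[of "real k" "?S / real ?n" "1 / p"] by (simp add: power_mean_real sum_nonneg)
  finally show ?thesis by (simp add: gen_power_mean_short[OF le])
qed

text \<open>
  Each inner mean is at most the \<open>p\<close>-norm of the entries it involves, and an index lies in
  a fraction \<open>k / n\<close> of all \<open>k\<close>-subsets.
\<close>

lemma gen_power_mean_le:
  assumes k: "k > 0" and p: "p > 0" and s: "s = ereal p \<or> s \<le> 0" and ne: "vs \<noteq> []"
    and vs: "\<And>i. i < length vs \<Longrightarrow> 0 < vs ! i"
  shows "gen_power_mean k s q vs
    \<le> real k powr (1 / p) * power_mean (ereal p) {..<length vs} (\<lambda>i. vs ! i)"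
proof (cases "length vs \<le> k")
  case True
  then show ?thesis using gen_power_mean_short_le p ne vs by blast
next
  case False
  then have less: "k < length vs" by simp
  let ?n = "length vs"
  let ?F = "{J. J \<subseteq> {..<?n} \<and> card J = k}"
  let ?N = "\<lambda>J. power_mean q J (\<lambda>i. vs ! i)"
  let ?S = "\<Sum>i<?n. (vs ! i) powr p"
  have F: "finite ?F" "?F \<noteq> {}"
    using less subsets_of_size_nonempty[of k ?n] by auto
  have N: "?N J > 0" if "J \<in> ?F" for J
    using subset_of_size_positive[OF that k vs] by (rule power_mean_pos)
  have NS: "?N J powr p \<le> (\<Sum>i\<in>J. (vs ! i) powr p)" if "J \<in> ?F" for J
  proof -
    have "?N J \<le> (\<Sum>i\<in>J. (vs ! i) powr p) powr (1 / p)"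
      using subset_of_size_positive[OF that k vs] p by (rule power_mean_le_powr_sum)
    then have "?N J powr p \<le> ((\<Sum>i\<in>J. (vs ! i) powr p) powr (1 / p)) powr p"
      using p N[OF that] by (intro powr_mono2) auto
    then show ?thesis using p by (simp add: powr_powr sum_nonneg)
  qed
  have "gen_power_mean k s q vs = power_mean s ?F ?N"
    by (rule gen_power_mean_long[OF less])
  also have "\<dots> \<le> power_mean (ereal p) ?F ?N"
    using s
  proof
    assume "s \<le> 0"
    then have "power_mean s ?F ?N \<le> power_mean 0 ?F ?N"
      using F N by (intro power_mean_le_geometric)
    also have "\<dots> \<le> power_mean (ereal p) ?F ?N"
      using F N p by (intro geometric_le_power_mean)
    finally show ?thesis .
  qed simp
  also have "\<dots> = ((\<Sum>J\<in>?F. ?N J powr p) / real (?n choose k)) powr (1 / p)"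
    using p by (simp add: power_mean_real n_subsets)
  also have "\<dots> \<le> ((\<Sum>J\<in>?F. \<Sum>i\<in>J. (vs ! i) powr p) / real (?n choose k)) powr (1 / p)"
    using p NS by (intro powr_mono2 divide_right_mono sum_mono) (auto simp: sum_nonneg)
  also have "(\<Sum>J\<in>?F. \<Sum>i\<in>J. (vs ! i) powr p) / real (?n choose k)
      = real ((?n - 1) choose (k - 1)) / real (?n choose k) * ?S"
    using sum_over_subsets[of "{..<?n}" k "\<lambda>i. (vs ! i) powr p"] k by simp
  also have "\<dots> = real k * (?S / real ?n)"
    using binomial_ratio[of k ?n] k less by simp
  also have "\<dots> powr (1 / p) = real k powr (1 / p) * power_mean (ereal p) {..<?n} (\<lambda>i. vs ! i)"
    using p powr_mult[of "real k" "?S / real ?n" "1 / p"] by (simp add: power_mean_real sum_nonneg)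
  finally show ?thesis .
qed

text \<open>
  The geometric mean of \<open>k\<close> entries is the product of their \<open>k\<close>-th roots, so the average over
  the subsets is an elementary symmetric polynomial in these roots, compared here with the
  \<open>k\<close>-th power of their arithmetic mean.
\<close>

lemma gen_power_mean_1_le:
  assumes k: "k > 0" and q: "q \<le> 0" and ne: "vs \<noteq> []"
    and vs: "\<And>i. i < length vs \<Longrightarrow> 0 < vs ! i"
  shows "gen_power_mean k 1 q vs
    \<le> real k powr real k * power_mean (ereal (1 / real k)) {..<length vs} (\<lambda>i. vs ! i)"
proof (cases "length vs \<le> k")
  case True
  then show ?thesis using gen_power_mean_short_le[of "1 / real k" vs k 1 q] k ne vs by simp
next
  case False
  then have less: "k < length vs" by simp
  let ?n = "length vs"
  let ?F = "{J. J \<subseteq> {..<?n} \<and> card J = k}"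
  let ?N = "\<lambda>J. power_mean q J (\<lambda>i. vs ! i)"
  let ?x = "\<lambda>i. (vs ! i) powr (1 / real k)"
  let ?S = "\<Sum>i<?n. ?x i"
  have S: "?S \<ge> 0" by (simp add: sum_nonneg)
  have N: "?N J > 0" "?N J \<le> (\<Prod>i\<in>J. ?x i)" if "J \<in> ?F" for J
  proof -
    note J = subset_of_size_positive[OF that k vs]
    show "?N J > 0" by (rule power_mean_pos[OF J])
    have "power_mean 0 J (\<lambda>i. vs ! i) = (\<Prod>i\<in>J. ?x i)"
      using that by (simp add: power_mean_zero prod_powr_distrib)
    then show "?N J \<le> (\<Prod>i\<in>J. ?x i)"
      using power_mean_le_geometric[where v = "\<lambda>i. vs ! i", OF J q] by simp
  qed
  have "gen_power_mean k 1 q vs = (\<Sum>J\<in>?F. ?N J) / real (?n choose k)"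
  proof -
    have "(\<Sum>J\<in>?F. ?N J powr 1) = (\<Sum>J\<in>?F. ?N J)" "(\<Sum>J\<in>?F. ?N J) \<ge> 0"
      using N by (auto intro!: sum.cong sum_nonneg simp: less_imp_le)
    then show ?thesis
      unfolding gen_power_mean_long[OF less] one_ereal_def
      by (subst power_mean_real) (simp_all add: n_subsets)
  qed
  also have "\<dots> \<le> ?S ^ k / real (?n choose k)"
  proof (rule divide_right_mono)
    have "(\<Sum>J\<in>?F. ?N J) \<le> (\<Sum>J\<in>?F. \<Prod>i\<in>J. ?x i)"
      by (rule sum_mono) (rule N(2))
    also have "\<dots> \<le> ?S ^ k"
      by (rule sum_prod_over_subsets_le) simp_all
    finally show "(\<Sum>J\<in>?F. ?N J) \<le> ?S ^ k" .
  qed simp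
  also have "\<dots> \<le> ?S ^ k / (real ?n / real k) ^ k"
    using binomial_ge_n_over_k_pow_k[of k ?n, where 'a = real] less k S ne
    by (intro divide_left_mono mult_pos_pos) auto
  also have "\<dots> = real k powr real k * (?S / real ?n) powr real k"
    using k S by (simp add: powr_realpow' power_divide)
  also have "(?S / real ?n) powr real k = power_mean (ereal (1 / real k)) {..<?n} (\<lambda>i. vs ! i)"
    using k by (simp add: power_mean_real)
  finally show ?thesis .
qed

text \<open>
  Only the subsets that contain the index \<open>0\<close> are kept. Their proportion \<open>k / n\<close> enters as
  \<open>(k / n) powr (1 / s)\<close>, and \<open>s \<ge> 1\<close> makes this at least \<open>k / n\<close>, hence at least \<open>1 / n\<close>.
\<close>

lemma gen_power_mean_ge_first:
  assumes k: "k > 0" and s: "s \<ge> 1" and q: "q > 0"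
  obtains c where "c > 0"
    "\<And>vs. k < length vs \<Longrightarrow> (\<And>i. i < length vs \<Longrightarrow> 0 < vs ! i) \<Longrightarrow>
      c * vs ! 0 / real (length vs) \<le> gen_power_mean k s q vs"
proof -
  obtain c where c: "c > 0" and low: "\<And>(J :: nat set) v i. card J = k \<Longrightarrow> i \<in> J \<Longrightarrow>
      (\<And>j. j \<in> J \<Longrightarrow> 0 < v j) \<Longrightarrow> c * v i \<le> power_mean q J v"
    using power_mean_ge_member[OF q k] by metis
  show ?thesis
  proof (rule that[OF c])
    fix vs :: "real list"
    assume less: "k < length vs" and vs: "\<And>i. i < length vs \<Longrightarrow> 0 < vs ! i"
    let ?n = "length vs"
    let ?F = "{J. J \<subseteq> {..<?n} \<and> card J = k}"
    let ?G = "{J. J \<subseteq> {..<?n} \<and> card J = k \<and> 0 \<in> J}"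
    let ?N = "\<lambda>J. power_mean q J (\<lambda>i. vs ! i)"
    let ?y = "c * vs ! 0"
    have F: "finite ?F" by simp
    have ne: "vs \<noteq> []" using less by auto
    have y: "?y > 0" using c vs[of 0] ne by simp
    have N0: "?y \<le> ?N J" if "J \<in> ?G" for J using low[of J 0] that vs by auto
    have card0: "card ?G = (?n - 1) choose (k - 1)"
      using card_subsets_containing[of "{..<?n}" 0 k] ne k by simp
    have ratio: "1 / real ?n \<le> real k / real ?n"  "real k / real ?n \<le> 1"
      using k less ne by (simp_all add: divide_right_mono)
    have "?y / real ?n \<le> power_mean s ?F ?N"
    proof (cases s)
      case (real t)
      then have t: "t \<ge> 1" using s by simp
      have "real (card ?G) * ?y powr t \<le> (\<Sum>J\<in>?G. ?N J powr t)"
        using N0 y t by (intro sum_bounded_below) (auto intro!: powr_mono2)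
      also have "\<dots> \<le> (\<Sum>J\<in>?F. ?N J powr t)"
        by (intro sum_mono2) auto
      finally have "real (card ?G) * ?y powr t / real (?n choose k)
          \<le> (\<Sum>J\<in>?F. ?N J powr t) / real (?n choose k)"
        by (rule divide_right_mono) simp
      moreover have "real (card ?G) * ?y powr t / real (?n choose k)
          = real k / real ?n * ?y powr t"
        unfolding card0 using binomial_ratio[OF k, of ?n] less by (metis less_imp_le times_divide_eq_left)
      ultimately have "real k / real ?n * ?y powr t
          \<le> (\<Sum>J\<in>?F. ?N J powr t) / real (?n choose k)"
        by simp
      then have "(real k / real ?n * ?y powr t) powr (1 / t)
          \<le> ((\<Sum>J\<in>?F. ?N J powr t) / real (?n choose k)) powr (1 / t)"
        using t by (intro powr_mono2) auto
      also have "\<dots> = power_mean s ?F ?N"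
        using t real by (simp add: power_mean_real n_subsets)
      also have "(real k / real ?n * ?y powr t) powr (1 / t) = (real k / real ?n) powr (1 / t) * ?y"
      proof -
        have "(?y powr t) powr (1 / t) = ?y"
          using t y by (simp only: powr_powr) simp
        then show ?thesis by (simp only: powr_mult)
      qed
      finally have "(real k / real ?n) powr (1 / t) * ?y \<le> power_mean s ?F ?N" .
      moreover have "(real k / real ?n) powr 1 \<le> (real k / real ?n) powr (1 / t)"
        using t ratio k less by (intro powr_mono') auto
      then have "1 / real ?n * ?y \<le> (real k / real ?n) powr (1 / t) * ?y"
        using ratio y k less by (intro mult_right_mono) auto
      ultimately show ?thesis by simp
    next
      case PInf
      have "card ?G > 0" using less k by (simp add: card0)
      then have "?G \<noteq> {}" unfolding card_gt_0_iff by (rule conjunct1)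
      then obtain J where J: "J \<in> ?G" unfolding ex_in_conv[symmetric] by (rule exE)
      then have "?N J \<le> Max (?N ` ?F)" using F by (intro Max_ge) auto
      moreover have "?y / real ?n \<le> ?y / 1"
      proof (rule divide_left_mono)
        show "1 \<le> real ?n" using less by simp
      qed (use y ne in simp_all)
      ultimately show ?thesis using N0[OF J] PInf by (simp add: power_mean_infinity)
    qed (use s in simp)
    then show "?y / real ?n \<le> gen_power_mean k s q vs"
      by (simp add: gen_power_mean_long[OF less])
  qed
qed

lemma not_hardy_mean_gen_power_mean:
  assumes k: "k > 0" and s: "s \<ge> 1" and q: "q > 0"
  shows "\<not> hardy_mean (gen_power_mean k s q)"
proof
  assume hardy: "hardy_mean (gen_power_mean k s q)"
  obtain c where c: "c > 0" and low: "\<And>vs. k < length vs \<Longrightarrow>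
      (\<And>i. i < length vs \<Longrightarrow> 0 < vs ! i) \<Longrightarrow>
      c * vs ! 0 / real (length vs) \<le> gen_power_mean k s q vs"
    using gen_power_mean_ge_first[OF k s q] by metis
  define a :: "nat \<Rightarrow> real" where "a = (\<lambda>n. (1 / 2) ^ n)"
  have "\<forall>n. a n > 0" "summable a" by (simp_all add: a_def summable_geometric)
  with hardy have "summable (\<lambda>n. gen_power_mean k s q (map a [0..<Suc n]))"
    unfolding hardy_mean_def by blast
  moreover have "norm (c * inverse (real (Suc n))) \<le> gen_power_mean k s q (map a [0..<Suc n])"
    if "n \<ge> k" for n
  proof -
    have "c * map a [0..<Suc n] ! 0 / real (length (map a [0..<Suc n]))
        \<le> gen_power_mean k s q (map a [0..<Suc n])"
      by (rule low) (use that in \<open>simp_all add: a_def del: upt_Suc\<close>)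
    moreover have "map a [0..<Suc n] ! 0 = 1" "length (map a [0..<Suc n]) = Suc n"
      by (simp_all add: a_def del: upt_Suc)
    ultimately show ?thesis
      using c by (simp add: divide_inverse abs_mult del: upt_Suc of_nat_Suc)
  qed
  ultimately have "summable (\<lambda>n. c * inverse (real (Suc n)))"
    by (rule summable_comparison_test'[where N = k])
  then have "summable (\<lambda>n. inverse (real (Suc n)))"
    using c by (simp only: summable_cmult_iff) simp
  then have "summable (\<lambda>n. inverse (real n))"
    by (rule summable_Suc_iff[THEN iffD1])
  then show False using not_summable_harmonic[where 'a = real] by simp
qed

theorem proposition1:
  fixes k :: nat
  assumes "k \<ge> 2"
  shows "(\<forall>s q :: ereal. s \<ge> 1 \<and> q > 0 \<longrightarrow> \<not> hardy_mean (gen_power_mean k s q)) \<and>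
    (\<forall>q :: ereal. q \<le> 0 \<longrightarrow> hardy_mean (gen_power_mean k 1 q)) \<and>
    (\<forall>s q :: ereal. s < 1 \<longrightarrow> hardy_mean (gen_power_mean k s q))"
proof (intro conjI allI impI)
  have k: "k > 0" using assms by simp
  show "\<not> hardy_mean (gen_power_mean k s q)" if "s \<ge> 1 \<and> q > 0" for s q
    using that not_hardy_mean_gen_power_mean[OF k] by blast
  show "hardy_mean (gen_power_mean k 1 q)" if "q \<le> 0" for q
    using assms gen_power_mean_1_le[OF k that] gen_power_mean_pos[OF k]
    by (intro hardy_mean_if_le_power_mean[where p = "1 / real k" and K = "real k powr real k"])
      (auto intro: less_imp_le)
  show "hardy_mean (gen_power_mean k s q)" if s: "s < 1" for s q
  proof -
    obtain p where p: "0 < p" "p < 1" "s = ereal p \<or> s \<le> 0"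
    proof (cases "s \<le> 0")
      case True
      then show ?thesis using that[of "1 / 2"] by simp
    next
      case False
      then show ?thesis using s that by (cases s) auto
    qed
    then show ?thesis
      using gen_power_mean_le[OF k p(1,3)] gen_power_mean_pos[OF k]
      by (intro hardy_mean_if_le_power_mean[where p = p and K = "real k powr (1 / p)"])
        (auto intro: less_imp_le)
  qed
qed

end
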